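(* Let $m\ge 3$ and $n\ge 0$ be integers and let $C_{m,n}$ be the weighted tree with vertices $E_0,E_1,\dots,E_n,F_1,\dots,F_m$, where $E_0$ has weight $3$, all other vertices have weight $2$, and the edges are those of the chain $E_n - E_{n-1} - \cdots - E_1 - E_0 - F_1 - F_2 - \cdots - F_{m-2} - F_{m-1}$ together with one edge joining $F_m$ and $F_{m-2}$. Then the number of elements of the triple root system $R(C_{m,n})$ is $$2m^2+4mn+n^2+2m+n.$$
   Context: For a finite weighted tree $\Gamma$ with vertices $V_i$ of weights $w_i$, the intersection form on $\bigoplus_i\mathbb{Z}V_i$ is the symmetric bilinear form with $(V_i\cdot V_i)=-w_i$ and, for $i\neq j$, $(V_i\cdot V_j)=1$ if $V_i$ and $V_j$ are joined by an edge and $0$ otherwise. A non-zero element $\sum m_iV_i$ is a positive (resp. negative) divisor if all $m_i\ge 0$ (resp. all $m_i\le 0$). The triple root system $R(\Gamma)$ is the set of all positive and negative divisors $Y$ with $(Y\cdot Y)=-2$ or $(Y\cdot Y)=-3$. *)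

theory Defs
  imports Main
begin

text \<open>Edges are two-element sets of vertices. The notions below make sense for every finite
  weighted graph; they are applied to trees.\<close>

record 'a weighted_graph =
  verts :: "'a set"
  edges :: "'a set set"
  weight :: "'a \<Rightarrow> int"

text \<open>The free abelian group on the (finitely many) vertices: integer coefficient functions,
  extended by zero to the whole type so that equal elements are equal functions.\<close>

definition lattice_elems :: "('a, 'b) weighted_graph_scheme \<Rightarrow> ('a \<Rightarrow> int) set" where
  "lattice_elems \<Gamma> = {D. \<forall>v. v \<notin> verts \<Gamma> \<longrightarrow> D v = 0}"

definition vertex_prod :: "('a, 'b) weighted_graph_scheme \<Rightarrow> 'a \<Rightarrow> 'a \<Rightarrow> int" where
  "vertex_prod \<Gamma> u v =
     (if u = v then - weight \<Gamma> u else if {u, v} \<in> edges \<Gamma> then 1 else 0)"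

definition intersection_form ::
    "('a, 'b) weighted_graph_scheme \<Rightarrow> ('a \<Rightarrow> int) \<Rightarrow> ('a \<Rightarrow> int) \<Rightarrow> int" where
  "intersection_form \<Gamma> D D' =
     (\<Sum>u\<in>verts \<Gamma>. \<Sum>v\<in>verts \<Gamma>. D u * D' v * vertex_prod \<Gamma> u v)"

definition positive_divisor :: "('a, 'b) weighted_graph_scheme \<Rightarrow> ('a \<Rightarrow> int) \<Rightarrow> bool" where
  "positive_divisor \<Gamma> D \<longleftrightarrow>
     D \<in> lattice_elems \<Gamma> \<and> D \<noteq> (\<lambda>_. 0) \<and> (\<forall>v\<in>verts \<Gamma>. D v \<ge> 0)"

definition negative_divisor :: "('a, 'b) weighted_graph_scheme \<Rightarrow> ('a \<Rightarrow> int) \<Rightarrow> bool" where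
  "negative_divisor \<Gamma> D \<longleftrightarrow>
     D \<in> lattice_elems \<Gamma> \<and> D \<noteq> (\<lambda>_. 0) \<and> (\<forall>v\<in>verts \<Gamma>. D v \<le> 0)"

definition triple_root_system :: "('a, 'b) weighted_graph_scheme \<Rightarrow> ('a \<Rightarrow> int) set" where
  "triple_root_system \<Gamma> =
     {Y. (positive_divisor \<Gamma> Y \<or> negative_divisor \<Gamma> Y) \<and>
         (intersection_form \<Gamma> Y Y = -2 \<or> intersection_form \<Gamma> Y Y = -3)}"

datatype C_vertex = E nat | F nat

text \<open>The tree \<open>C\<^sub>m\<^sub>,\<^sub>n\<close>, meaningful for \<open>m \<ge> 3\<close>. The first three sets of edges form the
  chain from \<open>E n\<close> through \<open>E 0\<close> and \<open>F 1\<close> to \<open>F (m - 1)\<close>.\<close>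

definition C_tree :: "nat \<Rightarrow> nat \<Rightarrow> C_vertex weighted_graph" where
  "C_tree m n =
     \<lparr> verts = E ` {0..n} \<union> F ` {1..m},
       edges = {{E i, E (i + 1)} | i. i < n} \<union> {{E 0, F 1}}
             \<union> {{F j, F (j + 1)} | j. 1 \<le> j \<and> j < m - 1} \<union> {{F m, F (m - 2)}},
       weight = (\<lambda>v. if v = E 0 then 3 else 2) \<rparr>"

end

theory Submission
  imports Defs
begin

text \<open>Order the vertices as \<open>E\<^sub>n, \<dots>, E\<^sub>0, F\<^sub>1, \<dots>, F\<^sub>m\<close> and, as for the root system of type \<open>D\<close>,
  write the coefficients of \<open>Y\<close> as partial sums of integers \<open>z\<^sub>0, \<dots>, z\<^bsub>n+m\<^esub>\<close> with even total; only the
  two end vertices of the fork need a modified formula. In these coordinates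
  \<open>-(Y \<cdot> Y) = a\<^sup>2 + \<Sum> z\<^sub>k\<^sup>2\<close>, where \<open>a = z\<^sub>0 + \<dots> + z\<^sub>n\<close> is the coefficient of \<open>E\<^sub>0\<close>. As \<open>\<Sum> z\<^sub>k\<^sup>2\<close> is even,
  \<open>-(Y \<cdot> Y) \<in> {2, 3}\<close> means \<open>\<Sum> z\<^sub>k\<^sup>2 = 2\<close> and \<open>\<bar>a\<bar> \<le> 1\<close>: exactly two coordinates are \<open>\<plusminus>1\<close>, and they
  have opposite signs if both are among \<open>z\<^sub>0, \<dots>, z\<^sub>n\<close>. The partial sums of such a vector never change
  sign, so all these \<open>Y\<close> are positive or negative divisors.\<close>

section \<open>Integer vectors with square sum two\<close>

lemma int_abs_1_cases: "\<bar>x::int\<bar> = 1 \<longleftrightarrow> x = 1 \<or> x = -1"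
  by linarith

text \<open>An integer and its square have the same parity. This links the even total of the
  coordinates to an even square sum.\<close>

lemma even_sum_power2_iff:
  fixes z :: "'a \<Rightarrow> int"
  shows "even (\<Sum>i\<in>A. (z i)\<^sup>2) \<longleftrightarrow> even (\<Sum>i\<in>A. z i)"
  by (induction A rule: infinite_finite_induct) auto

text \<open>Whether \<open>u\<close> and \<open>v\<close> lie in \<open>A\<close> is left open, so
  the lemma also evaluates sums over \<open>B\<close> and partial sums.\<close>

lemma sum_two_points:
  fixes z :: "'a \<Rightarrow> 'b::comm_monoid_add"
  assumes "finite A" "u \<noteq> v" "\<forall>i. i \<noteq> u \<longrightarrow> i \<noteq> v \<longrightarrow> z i = 0"
  shows "sum z A = (if u \<in> A then z u else 0) + (if v \<in> A then z v else 0)"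
proof -
  have "sum z A = (\<Sum>i\<in>A. (if u = i then z u else 0) + (if v = i then z v else 0))"
    using assms by (intro sum.cong) auto
  then show ?thesis
    using assms(1) by (simp add: sum.distrib)
qed

text \<open>An entry of absolute value at least 2 would contribute at least 4. Hence all entries are
  -1, 0 or 1, and the square sum counts the support.\<close>

lemma sum_power2_eq_2_iff:
  fixes z :: "'a \<Rightarrow> int"
  assumes "finite A" and supp: "\<forall>i. i \<notin> A \<longrightarrow> z i = 0"
  shows "(\<Sum>i\<in>A. (z i)\<^sup>2) = 2 \<longleftrightarrow>
    (\<exists>u\<in>A. \<exists>v\<in>A. u \<noteq> v \<and> \<bar>z u\<bar> = 1 \<and> \<bar>z v\<bar> = 1 \<and> (\<forall>i. i \<noteq> u \<longrightarrow> i \<noteq> v \<longrightarrow> z i = 0))"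
    (is "?L \<longleftrightarrow> ?R")
proof
  assume L: ?L
  have abs_le: "\<bar>z i\<bar> \<le> 1" if "i \<in> A" for i
  proof (rule ccontr)
    assume "\<not> \<bar>z i\<bar> \<le> 1"
    then have "2\<^sup>2 \<le> \<bar>z i\<bar>\<^sup>2"
      by (intro power_mono) auto
    moreover have "(z i)\<^sup>2 \<le> (\<Sum>i\<in>A. (z i)\<^sup>2)"
      using \<open>finite A\<close> that by (intro member_le_sum) auto
    ultimately show False
      using L by simp
  qed
  have abs_1: "\<bar>z i\<bar> = 1" if "z i \<noteq> 0" for i
    using abs_le[of i] supp that by (cases "i \<in> A") auto
  have "(\<Sum>i\<in>A. (z i)\<^sup>2) = (\<Sum>i\<in>A. if z i \<noteq> 0 then 1 else 0)"
    using abs_1 by (intro sum.cong refl) (metis one_power2 power2_abs zero_power2)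
  also have "\<dots> = int (card {i\<in>A. z i \<noteq> 0})"
    using \<open>finite A\<close> by (simp add: sum.If_cases Int_def)
  finally have "card {i\<in>A. z i \<noteq> 0} = 2"
    using L by simp
  then obtain u v where uv: "{i\<in>A. z i \<noteq> 0} = {u, v}" "u \<noteq> v"
    unfolding card_2_iff by blast
  have iff: "i \<in> A \<and> z i \<noteq> 0 \<longleftrightarrow> i = u \<or> i = v" for i
    using uv(1) by blast
  then have "u \<in> A" "v \<in> A" "\<bar>z u\<bar> = 1" "\<bar>z v\<bar> = 1"
    using abs_1 by auto
  moreover have "z i = 0" if "i \<noteq> u" "i \<noteq> v" for i
    using iff[of i] supp that by blast
  ultimately show ?R
    using uv(2) by blast
next
  assume ?R
  then obtain u v where uv: "u \<in> A" "v \<in> A" "u \<noteq> v" "\<bar>z u\<bar> = 1" "\<bar>z v\<bar> = 1"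
    "\<forall>i. i \<noteq> u \<longrightarrow> i \<noteq> v \<longrightarrow> z i = 0" by blast
  then have "(\<Sum>i\<in>A. (z i)\<^sup>2) = (z u)\<^sup>2 + (z v)\<^sup>2"
    using sum_two_points[of A u v "\<lambda>i. (z i)\<^sup>2"] \<open>finite A\<close> by simp
  moreover have "(z u)\<^sup>2 = 1" "(z v)\<^sup>2 = 1"
    using uv by (auto simp: int_abs_1_cases)
  ultimately show ?L by simp
qed

section \<open>Counting the coordinate vectors\<close>

definition short_vectors :: "'a set \<Rightarrow> 'a set \<Rightarrow> ('a \<Rightarrow> int) set" where
  "short_vectors A B =
     {z. (\<forall>i. i \<notin> A \<longrightarrow> z i = 0) \<and> (\<Sum>i\<in>A. (z i)\<^sup>2) = 2 \<and> \<bar>\<Sum>i\<in>B. z i\<bar> \<le> 1}"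

text \<open>Without the bound on \<open>B\<close> these are the roots of type D, four for each pair
  of positions. The bound removes exactly the two equal-sign vectors for each pair inside
  \<open>B\<close>.\<close>

lemma card_short_vectors:
  assumes "finite A" "B \<subseteq> A"
  shows "card (short_vectors A B) + card B * (card B - 1) = 2 * (card A * (card A - 1))"
proof -
  \<comment> \<open>Ordered pairs index the opposite-sign vectors, as swapping a pair negates the
    vector. Two-element sets index the equal-sign ones, which keeps \<open>p\<close> and
    \<open>q\<close> injective.\<close>
  define d where "d = (\<lambda>(u::'a, v) i. of_bool (i = u) - of_bool (i = v) :: int)"
  define p where "p = (\<lambda>(X::'a set) i. of_bool (i \<in> X) :: int)"
  define q where "q = (\<lambda>(X::'a set) i. - of_bool (i \<in> X) :: int)"
  define D where "D = A \<times> A - Id_on A"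
  define S where "S = {X. X \<subseteq> A \<and> card X = 2} - {X. X \<subseteq> B \<and> card X = 2}"
  have "finite B"
    using assms finite_subset by blast
  have fin: "finite D" "finite S"
    using assms by (auto simp: D_def S_def)
  have card_D: "card D = card A * (card A - 1)"
  proof -
    have "Id_on A = (\<lambda>i. (i, i)) ` A" by auto
    then have "card (Id_on A) = card A"
      by (simp add: card_image inj_on_def)
    moreover have "card D = card (A \<times> A) - card (Id_on A)"
      unfolding D_def using assms
      by (intro card_Diff_subset) (auto intro: finite_subset[of _ "A \<times> A"])
    ultimately show ?thesis
      by (simp add: card_cartesian_product diff_mult_distrib2)
  qed
  have card_S: "2 * card S + card B * (card B - 1) = card A * (card A - 1)"
  proof -
    have sub: "{X. X \<subseteq> B \<and> card X = 2} \<subseteq> {X. X \<subseteq> A \<and> card X = 2}"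
      using assms by auto
    have fin: "finite {X. X \<subseteq> A \<and> card X = 2}"
      using assms by auto
    have "card S = (card A choose 2) - (card B choose 2)"
      unfolding S_def card_Diff_subset[OF finite_subset[OF sub fin] sub]
      by (simp only: n_subsets \<open>finite A\<close> \<open>finite B\<close>)
    moreover have "(card B choose 2) \<le> (card A choose 2)"
      using card_mono[OF fin sub] by (simp only: n_subsets \<open>finite A\<close> \<open>finite B\<close>)
    moreover have "2 * (k choose 2) = k * (k - 1)" for k
      by (cases k) (auto simp: choose_two)
    note this[of "card A"] this[of "card B"]
    ultimately show ?thesis
      by linarith
  qed
  have "inj_on d D"
  proof (intro inj_onI, clarify)
    fix u v u' v' assume "(u, v) \<in> D" "(u', v') \<in> D" and eq: "d (u, v) = d (u', v')"
    then have "u \<noteq> v" "u' \<noteq> v'"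
      by (auto simp: D_def)
    then show "u = u' \<and> v = v'"
      using fun_cong[OF eq, of u] fun_cong[OF eq, of v]
      by (simp add: d_def of_bool_def split: if_splits)
  qed
  moreover have "inj p"
    by (rule inj_on_inverseI[where g = "\<lambda>z. {i. z i = 1}"]) (simp add: p_def)
  moreover have "inj q"
    by (rule inj_on_inverseI[where g = "\<lambda>z. {i. z i = -1}"]) (simp add: q_def)
  ultimately have inj: "inj_on d D" "inj_on p S" "inj_on q S"
    by (auto intro: inj_on_subset)
  have eq: "short_vectors A B = d ` D \<union> p ` S \<union> q ` S" (is "_ = ?R")
  proof (intro equalityI subsetI)
    fix z assume z: "z \<in> short_vectors A B"
    then obtain u v where uv: "u \<in> A" "v \<in> A" "u \<noteq> v" "\<bar>z u\<bar> = 1" "\<bar>z v\<bar> = 1"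
        "\<forall>i. i \<noteq> u \<longrightarrow> i \<noteq> v \<longrightarrow> z i = 0"
      unfolding short_vectors_def using sum_power2_eq_2_iff[OF \<open>finite A\<close>, of z] by auto
    \<comment> \<open>For equal signs this bound prevents \<open>u\<close> and \<open>v\<close> from
      both lying in \<open>B\<close>.\<close>
    have B: "\<bar>(if u \<in> B then z u else 0) + (if v \<in> B then z v else 0)\<bar> \<le> 1"
      using z sum_two_points[OF \<open>finite B\<close> uv(3,6)] by (simp add: short_vectors_def)
    consider "z u = 1" "z v = -1" | "z u = -1" "z v = 1" | "z u = 1" "z v = 1"
      | "z u = -1" "z v = -1"
      using uv by (auto simp: int_abs_1_cases)
    then show "z \<in> ?R"
    proof cases
      case 1
      then have "z = d (u, v)" "(u, v) \<in> D" using uv by (auto simp: d_def D_def fun_eq_iff)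
      then show ?thesis by blast
    next
      case 2
      then have "z = d (v, u)" "(v, u) \<in> D" using uv by (auto simp: d_def D_def fun_eq_iff)
      then show ?thesis by blast
    next
      case 3
      then have "z = p {u, v}" "{u, v} \<in> S" using uv B by (auto simp: p_def S_def fun_eq_iff)
      then show ?thesis by blast
    next
      case 4
      then have "z = q {u, v}" "{u, v} \<in> S" using uv B by (auto simp: q_def S_def fun_eq_iff)
      then show ?thesis by blast
    qed
  next
    have *: "z \<in> short_vectors A B"
      if "u \<in> A" "v \<in> A" "u \<noteq> v" "\<bar>z u\<bar> = 1" "\<bar>z v\<bar> = 1" "\<forall>i. i \<noteq> u \<longrightarrow> i \<noteq> v \<longrightarrow> z i = 0"
        "z u + z v = 0 \<or> \<not> (u \<in> B \<and> v \<in> B)" for z u v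
    proof -
      have supp: "\<forall>i. i \<notin> A \<longrightarrow> z i = 0" using that by auto
      moreover have "(\<Sum>i\<in>A. (z i)\<^sup>2) = 2"
        using sum_power2_eq_2_iff[OF \<open>finite A\<close> supp] that by blast
      moreover have "\<bar>\<Sum>i\<in>B. z i\<bar> \<le> 1"
        using sum_two_points[OF \<open>finite B\<close> that(3,6)] that by (auto split: if_splits)
      ultimately show ?thesis by (simp add: short_vectors_def)
    qed
    fix z assume "z \<in> ?R"
    then consider u v where "(u, v) \<in> D" "z = d (u, v)" | X where "X \<in> S" "z = p X \<or> z = q X"
      by auto
    then show "z \<in> short_vectors A B"
    proof cases
      case 1
      then show ?thesis by (intro *[of u v]) (auto simp: D_def d_def)
    next
      case 2
      then obtain u v where "X = {u, v}" "u \<noteq> v" by (auto simp: S_def card_2_iff)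
      then show ?thesis using 2 by (intro *[of u v]) (auto simp: S_def p_def q_def)
    qed
  qed
  \<comment> \<open>The three families are told apart by sign: both signs occur in \<open>d\<close>,
    only positive entries in \<open>p\<close>, only negative ones in \<open>q\<close>.\<close>
  have d_pos: "\<exists>i. z i > 0" and d_neg: "\<exists>i. z i < 0" if "z \<in> d ` D" for z
    using that by (auto simp: d_def D_def of_bool_def)
  have p_pos: "\<exists>i. z i > 0" if "z \<in> p ` S" for z
    using that by (auto simp: p_def S_def card_2_iff)
  have p_nonneg: "\<forall>i. z i \<ge> 0" if "z \<in> p ` S" for z
    using that by (auto simp: p_def)
  have q_nonpos: "\<forall>i. z i \<le> 0" if "z \<in> q ` S" for z
    using that by (auto simp: q_def)
  have disj: "d ` D \<inter> p ` S = {}" "(d ` D \<union> p ` S) \<inter> q ` S = {}"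
    using d_pos d_neg p_pos p_nonneg q_nonpos unfolding disjoint_iff Un_iff
    by (meson not_less)+
  have "card (short_vectors A B) = card D + card S + card S"
    unfolding eq using fin disj inj by (simp add: card_Un_disjoint card_image)
  then show ?thesis
    using card_D card_S by simp
qed

section \<open>The intersection form in a linear numbering of the vertices\<close>

text \<open>Counting from the far end \<open>E n\<close> makes every edge except the one at
  \<open>F m\<close> join consecutive positions.\<close>

definition C_vertex_at :: "nat \<Rightarrow> nat \<Rightarrow> C_vertex" where
  "C_vertex_at n k = (if k \<le> n then E (n - k) else F (k - n))"

lemma C_vertex_at_eq_iff: "C_vertex_at n j = C_vertex_at n k \<longleftrightarrow> j = k"
  by (auto simp: C_vertex_at_def)

lemma verts_C_tree: "verts (C_tree m n) = C_vertex_at n ` {..n + m}"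
proof -
  have "C_vertex_at n ` {..n} = E ` {0..n}"
    by (auto simp: C_vertex_at_def image_iff) (metis atMost_iff diff_diff_cancel diff_le_self)
  moreover have "C_vertex_at n ` {n<..n + m} = F ` {1..m}"
  proof -
    have "F j \<in> C_vertex_at n ` {n<..n + m}" if "1 \<le> j" "j \<le> m" for j
      using that by (intro image_eqI[of _ _ "n + j"]) (auto simp: C_vertex_at_def)
    moreover have "C_vertex_at n ` {n<..n + m} \<subseteq> F ` {1..m}"
      by (auto simp: C_vertex_at_def intro!: imageI)
    ultimately show ?thesis
      by auto
  qed
  moreover have "{..n + m} = {..n} \<union> {n<..n + m}"
    by auto
  ultimately show ?thesis
    by (simp add: C_tree_def image_Un)
qed

lemma edges_C_tree:
  assumes "m \<ge> 3"
  shows "edges (C_tree m n) = (\<lambda>k. {C_vertex_at n k, C_vertex_at n (Suc k)}) ` {..<n + m - 1} \<union>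
    {{C_vertex_at n (n + m - 2), C_vertex_at n (n + m)}}"
proof -
  let ?e = "\<lambda>k. {C_vertex_at n k, C_vertex_at n (Suc k)}"
  have "{{E i, E (i + 1)} | i. i < n} = ?e ` {..<n}"
  proof (intro equalityI subsetI)
    fix e assume "e \<in> {{E i, E (i + 1)} | i. i < n}"
    then obtain i where "e = {E i, E (i + 1)}" "i < n" by auto
    \<comment> \<open>The numbering runs against the index of \<open>E\<close>, which reverses these
      edges.\<close>
    then have "e = ?e (n - Suc i)" "n - Suc i < n" by (auto simp: C_vertex_at_def)
    then show "e \<in> ?e ` {..<n}" by blast
  next
    fix e assume "e \<in> ?e ` {..<n}"
    then obtain k where "k < n" "e = ?e k" by auto
    then have "e = {E (n - Suc k), E (n - Suc k + 1)}" "n - Suc k < n"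
      by (auto simp: C_vertex_at_def Suc_diff_Suc)
    then show "e \<in> {{E i, E (i + 1)} | i. i < n}" by blast
  qed
  moreover have "{{F j, F (j + 1)} | j. 1 \<le> j \<and> j < m - 1} = ?e ` {n<..<n + m - 1}"
  proof (intro equalityI subsetI)
    fix e assume "e \<in> {{F j, F (j + 1)} | j. 1 \<le> j \<and> j < m - 1}"
    then obtain j where "e = {F j, F (j + 1)}" "1 \<le> j" "j < m - 1" by auto
    then have "e = ?e (n + j)" "n + j \<in> {n<..<n + m - 1}" by (auto simp: C_vertex_at_def)
    then show "e \<in> ?e ` {n<..<n + m - 1}" by blast
  next
    fix e assume "e \<in> ?e ` {n<..<n + m - 1}"
    then obtain k where "n < k" "k < n + m - 1" "e = ?e k" by auto
    then have "e = {F (k - n), F (k - n + 1)}" "1 \<le> k - n" "k - n < m - 1"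
      by (auto simp: C_vertex_at_def Suc_diff_le)
    then show "e \<in> {{F j, F (j + 1)} | j. 1 \<le> j \<and> j < m - 1}" by blast
  qed
  moreover have "{E 0, F 1} = ?e n"
    by (simp add: C_vertex_at_def)
  \<comment> \<open>Since \<open>m \<ge> 3\<close>, position \<open>n + m - 2\<close> lies beyond
    \<open>n\<close>, so it is an \<open>F\<close> vertex.\<close>
  moreover have "{F m, F (m - 2)} = {C_vertex_at n (n + m - 2), C_vertex_at n (n + m)}"
    using assms by (auto simp: C_vertex_at_def)
  moreover have "{..<n + m - 1} = {..<n} \<union> {n} \<union> {n<..<n + m - 1}"
    using assms by auto
  ultimately show ?thesis
    by (simp add: C_tree_def image_Un)
qed

text \<open>\<open>M\<close> is the position of the fork vertex \<open>F (m - 2)\<close>, given by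
  an equation free of truncated subtraction. The ordered adjacent pairs form disjoint cases, so a
  sum of indicators describes the matrix and lets the double sum split.\<close>

lemma vertex_prod_C_tree:
  assumes "m \<ge> 3" and M: "M + 2 = n + m" and "j \<le> M + 2" "k \<le> M + 2"
  shows "vertex_prod (C_tree m n) (C_vertex_at n j) (C_vertex_at n k) =
    of_bool (k = Suc j \<and> j \<le> M) + of_bool (j = Suc k \<and> k \<le> M)
    + of_bool (j = M \<and> k = M + 2) + of_bool (k = M \<and> j = M + 2)
    - 2 * of_bool (j = k) - of_bool (j = n \<and> k = n)"
proof -
  have weight: "weight (C_tree m n) (C_vertex_at n j) = 2 + of_bool (j = n)"
    by (auto simp: C_tree_def C_vertex_at_def)
  have edge: "{C_vertex_at n j, C_vertex_at n k} \<in> edges (C_tree m n) \<longleftrightarrow>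
    k = Suc j \<and> j \<le> M \<or> j = Suc k \<and> k \<le> M \<or> j = M \<and> k = M + 2 \<or> k = M \<and> j = M + 2"
  proof -
    have "{..<n + m - 1} = {..M}" "n + m - 2 = M" "n + m = M + 2"
      using M by auto
    then show ?thesis
      unfolding edges_C_tree[OF \<open>m \<ge> 3\<close>]
      by (auto simp: doubleton_eq_iff C_vertex_at_eq_iff image_iff)
  qed
  consider "j = k" | "k = Suc j" "j \<le> M" | "j = Suc k" "k \<le> M"
    | "j = M" "k = M + 2" | "k = M" "j = M + 2"
    | "j \<noteq> k" "\<not> (k = Suc j \<and> j \<le> M)" "\<not> (j = Suc k \<and> k \<le> M)"
      "\<not> (j = M \<and> k = M + 2)" "\<not> (k = M \<and> j = M + 2)"
    by blast
  then show ?thesis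
    unfolding vertex_prod_def C_vertex_at_eq_iff edge weight by cases simp_all
qed

text \<open>Each indicator is supported on the graph of a partial function \<open>g\<close> with
  domain \<open>P\<close>, so every inner sum has at most one nonzero term.\<close>

lemma sum_sum_of_bool_graph:
  fixes f :: "'a \<Rightarrow> 'b \<Rightarrow> 'c::semiring_1"
  assumes "finite I" "finite J" "\<And>i. i \<in> I \<Longrightarrow> P i \<Longrightarrow> g i \<in> J"
  shows "(\<Sum>i\<in>I. \<Sum>j\<in>J. f i j * of_bool (j = g i \<and> P i)) = (\<Sum>i\<in>{i\<in>I. P i}. f i (g i))"
proof -
  have "(\<Sum>j\<in>J. f i j * of_bool (j = g i \<and> P i)) = (if P i then f i (g i) else 0)"
    if "i \<in> I" for i
    using assms that by (cases "P i") (simp_all add: of_bool_def if_distrib cong: if_cong)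
  then have "(\<Sum>i\<in>I. \<Sum>j\<in>J. f i j * of_bool (j = g i \<and> P i)) =
      (\<Sum>i\<in>I. if P i then f i (g i) else 0)"
    by (rule sum.cong[OF refl])
  then show ?thesis
    using \<open>finite I\<close> by (simp add: sum.inter_filter)
qed

lemma intersection_form_C_tree:
  fixes Y :: "C_vertex \<Rightarrow> int"
  assumes "m \<ge> 3" and M: "M + 2 = n + m"
  defines "y \<equiv> \<lambda>k. Y (C_vertex_at n k)"
  shows "intersection_form (C_tree m n) Y Y =
    2 * (\<Sum>k\<le>M. y k * y (Suc k)) + 2 * y M * y (M + 2) - 2 * (\<Sum>k\<le>M + 2. (y k)\<^sup>2) - (y n)\<^sup>2"
proof -
  let ?I = "{..M + 2}"
  have inj: "inj_on (C_vertex_at n) A" for A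
    by (simp add: inj_on_def C_vertex_at_eq_iff)
  have verts: "verts (C_tree m n) = C_vertex_at n ` ?I"
    using verts_C_tree[of m n] M by simp
  have "intersection_form (C_tree m n) Y Y =
    (\<Sum>j\<in>?I. \<Sum>k\<in>?I. y j * y k * vertex_prod (C_tree m n) (C_vertex_at n j) (C_vertex_at n k))"
    unfolding intersection_form_def verts by (simp add: sum.reindex[OF inj] y_def)
  also have "\<dots> = (\<Sum>j\<in>?I. \<Sum>k\<in>?I.
      y j * y k * of_bool (k = Suc j \<and> j \<le> M) + y j * y k * of_bool (j = Suc k \<and> k \<le> M)
      + y j * y k * of_bool (j = M \<and> k = M + 2) + y j * y k * of_bool (k = M \<and> j = M + 2)
      - 2 * (y j * y k * of_bool (j = k)) - y j * y k * of_bool (j = n \<and> k = n))"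
    by (intro sum.cong refl)
      (subst vertex_prod_C_tree[OF assms(1,2)], auto simp: algebra_simps)
  also have "\<dots> = (\<Sum>j\<in>?I. \<Sum>k\<in>?I. y j * y k * of_bool (k = Suc j \<and> j \<le> M))
      + (\<Sum>j\<in>?I. \<Sum>k\<in>?I. y j * y k * of_bool (j = Suc k \<and> k \<le> M))
      + (\<Sum>j\<in>?I. \<Sum>k\<in>?I. y j * y k * of_bool (j = M \<and> k = M + 2))
      + (\<Sum>j\<in>?I. \<Sum>k\<in>?I. y j * y k * of_bool (k = M \<and> j = M + 2))
      - 2 * (\<Sum>j\<in>?I. \<Sum>k\<in>?I. y j * y k * of_bool (j = k))
      - (\<Sum>j\<in>?I. \<Sum>k\<in>?I. y j * y k * of_bool (j = n \<and> k = n))"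
    by (simp only: sum.distrib sum_subtractf sum_distrib_left)
  \<comment> \<open>Exchanging the summations identifies the two orientations of the chain edges,
    hence the factor 2.\<close>
  also have "(\<Sum>j\<in>?I. \<Sum>k\<in>?I. y j * y k * of_bool (j = Suc k \<and> k \<le> M)) =
      (\<Sum>j\<in>?I. \<Sum>k\<in>?I. y j * y k * of_bool (k = Suc j \<and> j \<le> M))"
    by (subst sum.swap) (simp add: mult.commute)
  also have "(\<Sum>j\<in>?I. \<Sum>k\<in>?I. y j * y k * of_bool (k = Suc j \<and> j \<le> M)) =
      (\<Sum>k\<le>M. y k * y (Suc k))"
  proof -
    have "{j \<in> ?I. j \<le> M} = {..M}" by auto
    then show ?thesis
      by (subst sum_sum_of_bool_graph) auto
  qed
  also have "(\<Sum>j\<in>?I. \<Sum>k\<in>?I. y j * y k * of_bool (k = M \<and> j = M + 2)) = y (M + 2) * y M"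
  proof -
    have "{j \<in> ?I. j = M + 2} = {M + 2}" by auto
    then show ?thesis
      by (subst sum_sum_of_bool_graph) auto
  qed
  also have "(\<Sum>j\<in>?I. \<Sum>k\<in>?I. y j * y k * of_bool (j = M \<and> k = M + 2)) = y M * y (M + 2)"
  proof -
    have "{j \<in> ?I. j = M} = {M}" by auto
    then show ?thesis
      by (subst conj_commute, subst sum_sum_of_bool_graph) auto
  qed
  also have "(\<Sum>j\<in>?I. \<Sum>k\<in>?I. y j * y k * of_bool (j = k)) = (\<Sum>k\<in>?I. (y k)\<^sup>2)"
    using sum_sum_of_bool_graph[of ?I ?I "\<lambda>_. True" "\<lambda>j. j" "\<lambda>j k. y j * y k"]
    by (simp add: power2_eq_square eq_commute)
  also have "(\<Sum>j\<in>?I. \<Sum>k\<in>?I. y j * y k * of_bool (j = n \<and> k = n)) = (y n)\<^sup>2"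
  proof -
    have "{j \<in> ?I. j = n} = {n}" using M \<open>m \<ge> 3\<close> by auto
    then show ?thesis
      using M \<open>m \<ge> 3\<close>
      by (subst conj_commute, subst sum_sum_of_bool_graph) (auto simp: power2_eq_square)
  qed
  finally show ?thesis
    by simp
qed

section \<open>Passage to coordinates of type D and back\<close>

text \<open>In the standard coordinates of \<open>D\<^sub>m\<close> the simple roots at the two ends of the fork are
  \<open>\<epsilon>\<^bsub>m-1\<^esub> - \<epsilon>\<^sub>m\<close> and \<open>\<epsilon>\<^bsub>m-1\<^esub> + \<epsilon>\<^sub>m\<close>, which explains the last two values. Keeping the last one constant
  beyond \<open>n + m\<close> makes all later differences vanish.\<close>

definition C_prefix :: "nat \<Rightarrow> nat \<Rightarrow> (C_vertex \<Rightarrow> int) \<Rightarrow> nat \<Rightarrow> int" where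
  "C_prefix m n Y k =
     (if k < n + m - 1 then Y (C_vertex_at n k)
      else if k = n + m - 1 then Y (F (m - 1)) + Y (F m)
      else 2 * Y (F m))"

definition C_coords :: "nat \<Rightarrow> nat \<Rightarrow> (C_vertex \<Rightarrow> int) \<Rightarrow> nat \<Rightarrow> int" where
  "C_coords m n Y k = C_prefix m n Y k - (if k = 0 then 0 else C_prefix m n Y (k - 1))"

text \<open>This solves the equations of \<open>C_prefix\<close> for \<open>Y\<close>: the full sum
  stands for \<open>2 * Y (F m)\<close>, and the one before it for
  \<open>Y (F (m - 1)) + Y (F m)\<close>. The zero branches put the result into the lattice.\<close>

definition C_of_coords :: "nat \<Rightarrow> nat \<Rightarrow> (nat \<Rightarrow> int) \<Rightarrow> C_vertex \<Rightarrow> int" where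
  "C_of_coords m n z v =
     (case v of
        E i \<Rightarrow> if i \<le> n then \<Sum>k\<le>n - i. z k else 0
      | F j \<Rightarrow>
          if j = 0 \<or> j > m then 0
          else if j = m then (\<Sum>k\<le>n + m. z k) div 2
          else if j = m - 1 then (\<Sum>k\<le>n + j. z k) - (\<Sum>k\<le>n + m. z k) div 2
          else \<Sum>k\<le>n + j. z k)"

lemma sum_C_coords: "(\<Sum>i\<le>k. C_coords m n Y i) = C_prefix m n Y k"
  by (induction k) (auto simp: C_coords_def)

lemma C_coords_eq_0:
  assumes "m \<ge> 3" "k > n + m"
  shows "C_coords m n Y k = 0"
  using assms by (auto simp: C_coords_def C_prefix_def)

lemma C_of_coords_coords:
  assumes "m \<ge> 3" "Y \<in> lattice_elems (C_tree m n)"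
  shows "C_of_coords m n (C_coords m n Y) = Y"
proof
  fix v
  have supp: "Y (E i) = 0" if "i > n" for i
    using that assms by (auto simp: lattice_elems_def C_tree_def image_iff)
  have supp': "Y (F j) = 0" if "j = 0 \<or> j > m" for j
    using that assms by (auto simp: lattice_elems_def C_tree_def image_iff)
  show "C_of_coords m n (C_coords m n Y) v = Y v"
    using supp supp' assms(1)
    by (cases v) (auto simp: C_of_coords_def sum_C_coords C_prefix_def C_vertex_at_def)
qed

text \<open>Parity matters only at \<open>k = n + m\<close>, where a halved total is doubled again;
  at \<open>n + m - 1\<close> the two halves cancel.\<close>

lemma C_prefix_of_coords:
  assumes "m \<ge> 3" "even (\<Sum>i\<le>n + m. z i)" "k \<le> n + m"
  shows "C_prefix m n (C_of_coords m n z) k = (\<Sum>i\<le>k. z i)"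
proof -
  consider "k \<le> n" | "n < k" "k < n + m - 1" | "k = n + m - 1" | "k = n + m"
    using assms(3) by linarith
  then show ?thesis
    using assms(1,2) by cases (auto simp: C_prefix_def C_of_coords_def C_vertex_at_def)
qed

lemma C_coords_of_coords:
  assumes "m \<ge> 3" "even (\<Sum>i\<le>n + m. z i)" "\<forall>k. k \<notin> {..n + m} \<longrightarrow> z k = 0"
  shows "C_coords m n (C_of_coords m n z) = z"
proof
  fix k
  show "C_coords m n (C_of_coords m n z) k = z k"
  proof (cases "k \<le> n + m")
    case True
    then show ?thesis
      using C_prefix_of_coords[OF assms(1,2)] by (cases k) (auto simp: C_coords_def)
  next
    case False
    then show ?thesis
      using C_coords_eq_0[OF assms(1)] assms(3) by simp
  qed
qed

section \<open>Diagonalizing the form\<close>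

text \<open>Each \<open>y k\<close> occurs in two differences, except that \<open>y K\<close> occurs
  in one, which leaves the boundary term.\<close>

lemma sum_power2_differences:
  fixes y :: "nat \<Rightarrow> int"
  shows "(\<Sum>k\<le>K. (y k - (if k = 0 then 0 else y (k - 1)))\<^sup>2) =
    2 * (\<Sum>k\<le>K. (y k)\<^sup>2) - (y K)\<^sup>2 - 2 * (\<Sum>k<K. y k * y (Suc k))"
  by (induction K) (auto simp: power2_eq_square algebra_simps)

text \<open>With \<open>b = y (Suc M)\<close> and \<open>c = y (M + 2)\<close>, the last two
  coordinates are \<open>b + c - y M\<close> and \<open>c - b\<close>. Their squares add up to
  \<open>2 * b\<^sup>2 + 2 * c\<^sup>2 + (y M)\<^sup>2 - 2 * y M * (b + c)\<close>, which cancels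
  the boundary term of the chain and supplies both fork edges. The extra weight of
  \<open>E 0\<close> gives the square of the first sum.\<close>

lemma intersection_form_C_coords:
  assumes "m \<ge> 3"
  shows "intersection_form (C_tree m n) Y Y =
    - (\<Sum>k\<le>n. C_coords m n Y k)\<^sup>2 - (\<Sum>k\<le>n + m. (C_coords m n Y k)\<^sup>2)"
proof -
  define M where "M = n + m - 2"
  define y where "y k = Y (C_vertex_at n k)" for k
  have M: "M + 2 = n + m"
    using assms by (simp add: M_def)
  have n: "(\<Sum>k\<le>n. C_coords m n Y k) = y n"
  proof -
    have "n < n + m - 1" using assms by simp
    then show ?thesis
      unfolding sum_C_coords by (simp only: C_prefix_def y_def if_True)
  qed
  have prefix: "C_prefix m n Y k = y k" if "k \<le> M" for k
    using that M by (auto simp: C_prefix_def y_def)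
  have prefix1: "C_prefix m n Y (Suc M) = y (Suc M) + y (M + 2)"
    and prefix2: "C_prefix m n Y (M + 2) = 2 * y (M + 2)"
    using M assms by (auto simp: C_prefix_def y_def C_vertex_at_def M_def Suc_diff_le
        intro: arg_cong[of _ _ Y])
  have "(\<Sum>k\<le>M. (C_coords m n Y k)\<^sup>2) = (\<Sum>k\<le>M. (y k - (if k = 0 then 0 else y (k - 1)))\<^sup>2)"
    by (intro sum.cong) (auto simp: C_coords_def prefix)
  moreover have "C_coords m n Y (Suc M) = y (Suc M) + y (M + 2) - y M"
    by (simp add: C_coords_def prefix prefix1)
  moreover have "C_coords m n Y (M + 2) = y (M + 2) - y (Suc M)"
    using prefix1 prefix2 by (simp add: C_coords_def)
  moreover have "(\<Sum>k\<le>n + m. (C_coords m n Y k)\<^sup>2) = (\<Sum>k\<le>M. (C_coords m n Y k)\<^sup>2)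
      + (C_coords m n Y (Suc M))\<^sup>2 + (C_coords m n Y (M + 2))\<^sup>2"
    unfolding M[symmetric] by simp
  ultimately have "(\<Sum>k\<le>n + m. (C_coords m n Y k)\<^sup>2) = 2 * (\<Sum>k\<le>M. (y k)\<^sup>2) - (y M)\<^sup>2
      - 2 * (\<Sum>k<M. y k * y (Suc k)) + (y (Suc M) + y (M + 2) - y M)\<^sup>2
      + (y (M + 2) - y (Suc M))\<^sup>2"
    by (simp only: sum_power2_differences)
  also have "\<dots> = 2 * (\<Sum>k\<le>M + 2. (y k)\<^sup>2) - 2 * (\<Sum>k\<le>M. y k * y (Suc k)) - 2 * y M * y (M + 2)"
    by (simp add: lessThan_Suc_atMost[symmetric] power2_eq_square algebra_simps)
  finally show ?thesis
    unfolding intersection_form_C_tree[OF assms M] n y_def[symmetric] by simp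
qed

section \<open>The bijection and the count\<close>

text \<open>With nonzero entries at \<open>u < v\<close>, partial sums are \<open>z u\<close> from
  \<open>u\<close> up to \<open>v - 1\<close>, then 0 or \<open>2 * z u\<close>. So they keep the
  sign of \<open>z u\<close>, and halving the total keeps it too. At \<open>F (m - 1)\<close> the
  value is half the total if \<open>v < n + m\<close>; if \<open>v = n + m\<close> it is
  \<open>z u\<close> minus half the total, again 0 or \<open>z u\<close>.\<close>

lemma C_of_coords_sign:
  assumes "m \<ge> 3" and supp: "\<forall>k. k \<notin> {..n + m} \<longrightarrow> z k = 0" and "(\<Sum>k\<le>n + m. (z k)\<^sup>2) = 2"
  shows "(\<forall>v. C_of_coords m n z v \<ge> 0) \<or> (\<forall>v. C_of_coords m n z v \<le> 0)"
proof -
  obtain u v where uv: "u < v" "v \<le> n + m" "\<bar>z u\<bar> = 1" "\<bar>z v\<bar> = 1"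
    "\<forall>i. i \<noteq> u \<longrightarrow> i \<noteq> v \<longrightarrow> z i = 0"
  proof -
    obtain u v where "u \<le> n + m" "v \<le> n + m" "u \<noteq> v" "\<bar>z u\<bar> = 1" "\<bar>z v\<bar> = 1"
      "\<forall>i. i \<noteq> u \<longrightarrow> i \<noteq> v \<longrightarrow> z i = 0"
      using sum_power2_eq_2_iff[OF finite_atMost supp] assms(3) by auto
    then show ?thesis
      using that[of u v] that[of v u] by (cases "u < v") auto
  qed
  have P: "(\<Sum>i\<le>k. z i) = (if u \<le> k then z u else 0) + (if v \<le> k then z v else 0)" for k
    using sum_two_points[OF finite_atMost, of u v z k] uv by simp
  have "z u = 1 \<and> z v = 1 \<or> z u = 1 \<and> z v = -1 \<or> z u = -1 \<and> z v = 1 \<or> z u = -1 \<and> z v = -1"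
    using uv by (auto simp: int_abs_1_cases)
  then show ?thesis
    using uv(1,2)
    by (elim disjE; simp add: C_of_coords_def P split: C_vertex.split; fastforce?)
qed

lemma bij_betw_C_coords:
  assumes "m \<ge> 3"
  shows "bij_betw (C_coords m n) (triple_root_system (C_tree m n)) (short_vectors {..n + m} {..n})"
proof (rule bij_betw_byWitness[where f' = "C_of_coords m n"])
  let ?R = "triple_root_system (C_tree m n)" and ?S = "short_vectors {..n + m} {..n}"
  have even: "even (\<Sum>k\<le>n + m. z k)" if "z \<in> ?S" for z
    using that even_sum_power2_iff[of z "{..n + m}"] by (simp add: short_vectors_def)
  have lattice: "Y \<in> lattice_elems (C_tree m n)" if "Y \<in> ?R" for Y
    using that by (auto simp: triple_root_system_def positive_divisor_def negative_divisor_def)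
  show "\<forall>Y\<in>?R. C_of_coords m n (C_coords m n Y) = Y"
    using C_of_coords_coords[OF assms] lattice by blast
  show inv: "\<forall>z\<in>?S. C_coords m n (C_of_coords m n z) = z"
    using C_coords_of_coords[OF assms even] by (auto simp: short_vectors_def)
  show "C_coords m n ` ?R \<subseteq> ?S"
  proof clarify
    fix Y assume "Y \<in> ?R"
    define z where "z = C_coords m n Y"
    define a where "a = (\<Sum>k\<le>n. z k)"
    define s where "s = (\<Sum>k\<le>n + m. (z k)\<^sup>2)"
    have q: "2 \<le> a\<^sup>2 + s" "a\<^sup>2 + s \<le> 3"
      using \<open>Y \<in> ?R\<close> intersection_form_C_coords[OF assms, of n Y]
      by (auto simp: triple_root_system_def z_def a_def s_def)
    have "(\<Sum>k\<le>n + m. z k) = 2 * Y (F m)"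
      using assms by (auto simp: z_def sum_C_coords C_prefix_def)
    then have "even s"
      by (simp add: s_def even_sum_power2_iff)
    \<comment> \<open>If \<open>s\<close> vanished, so would all coordinates and with them
      \<open>a\<close>, against the lower bound in \<open>q\<close>.\<close>
    have "s \<noteq> 0"
    proof
      assume "s = 0"
      then have "\<forall>k\<in>{..n + m}. (z k)\<^sup>2 = 0"
        unfolding s_def by (subst (asm) sum_nonneg_eq_0_iff) auto
      then have "a = 0"
        by (simp add: a_def)
      then show False
        using \<open>s = 0\<close> q by simp
    qed
    moreover have "s \<ge> 0"
      by (simp add: s_def sum_nonneg)
    moreover have "s \<le> 3"
      using q(2) zero_le_power2[of a] by linarith
    ultimately have "s = 2"
      using \<open>even s\<close> by presburger
    then have "\<bar>a\<bar> \<le> 1"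
      using q(2) by (simp add: abs_square_le_1)
    then show "C_coords m n Y \<in> ?S"
      using \<open>s = 2\<close> C_coords_eq_0[OF assms]
      by (simp add: short_vectors_def a_def s_def z_def)
  qed
  show "C_of_coords m n ` ?S \<subseteq> ?R"
  proof clarify
    fix z assume z: "z \<in> ?S"
    let ?Y = "C_of_coords m n z"
    have lat: "?Y \<in> lattice_elems (C_tree m n)"
      using assms
      by (auto simp: lattice_elems_def C_tree_def C_of_coords_def image_iff split: C_vertex.split)
    have s: "(\<Sum>k\<le>n + m. (z k)\<^sup>2) = 2" and a: "\<bar>\<Sum>k\<le>n. z k\<bar> \<le> 1"
      and supp: "\<forall>k. k \<notin> {..n + m} \<longrightarrow> z k = 0"
      using z by (auto simp: short_vectors_def)
    have "(\<Sum>k\<le>n. z k) = 0 \<or> (\<Sum>k\<le>n. z k) = 1 \<or> (\<Sum>k\<le>n. z k) = -1"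
      using a by linarith
    \<comment> \<open>The form equals -2 minus the square of the sum up to \<open>n\<close>: -2 if
      that sum is 0, and -3 if it is 1 or -1.\<close>
    then have form: "intersection_form (C_tree m n) ?Y ?Y = -2 \<or>
        intersection_form (C_tree m n) ?Y ?Y = -3"
      unfolding intersection_form_C_coords[OF assms] using inv z s by auto
    have "?Y \<noteq> (\<lambda>_. 0)"
      using form by (auto simp: intersection_form_def)
    then show "?Y \<in> ?R"
      using lat form C_of_coords_sign[OF assms supp s]
      by (auto simp: triple_root_system_def positive_divisor_def negative_divisor_def)
  qed
qed

theorem proposition3p17:
  fixes m n :: nat
  assumes "m \<ge> 3"
  shows "card (triple_root_system (C_tree m n)) = 2 * m^2 + 4 * m * n + n^2 + 2 * m + n"
proof -
  have "card (triple_root_system (C_tree m n)) = card (short_vectors {..n + m} {..n})"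
    using bij_betw_C_coords[OF assms] by (rule bij_betw_same_card)
  \<comment> \<open>The two index sets have \<open>n + m + 1\<close> and \<open>n + 1\<close>
    elements.\<close>
  moreover have "card (short_vectors {..n + m} {..n}) + Suc n * n = 2 * (Suc (n + m) * (n + m))"
    using card_short_vectors[of "{..n + m}" "{..n}"] by simp
  ultimately show ?thesis
    by (simp add: power2_eq_square algebra_simps)
qed

end
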